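(* Let $\Omega$ be a finite set and let $P$ be a strongly regular partition of $\mathcal{P}(\Omega)$. Then for any two blocs $\mathsf{B}_i$ and $\mathsf{B}_j$ of $P$ and any integer $r$, the number of members $B$ of $\mathsf{B}_j$ with $|A\cap B|=r$, where $A$ is a given member of $\mathsf{B}_i$, is independent of the choice of $A$ in $\mathsf{B}_i$.
   Context: $\mathcal{P}(\Omega)$ is the powerset of $\Omega$. A strongly regular partition of $\mathcal{P}(\Omega)$ is a partition of $\mathcal{P}(\Omega)$ into (nonempty) blocs $\mathsf{B}_1,\ldots,\mathsf{B}_s$ such that: (1) all sets in a given bloc have the same size; (2) for any bloc $\mathsf{B}_i$, the set of all complements (in $\Omega$) of the members of $\mathsf{B}_i$ is also a bloc; (3) for any two blocs $\mathsf{B}_i$ and $\mathsf{B}_j$, the number of members of $\mathsf{B}_j$ that are included in a member $A$ of $\mathsf{B}_i$ is independent of the choice of $A$ in $\mathsf{B}_i$. *)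

theory Defs
  imports Main "HOL-Library.Disjoint_Sets"
begin

(* "Any two blocs" in condition (3) includes the case where the blocs coincide. *)
definition strongly_regular_partition :: "'a set \<Rightarrow> 'a set set set \<Rightarrow> bool" where
  "strongly_regular_partition \<Omega> P \<longleftrightarrow>
     partition_on (Pow \<Omega>) P \<and>
     (\<forall>\<B>\<in>P. \<forall>A\<in>\<B>. \<forall>A'\<in>\<B>. card A = card A') \<and>
     (\<forall>\<B>\<in>P. (\<lambda>A. \<Omega> - A) ` \<B> \<in> P) \<and>
     (\<forall>\<B>\<in>P. \<forall>\<C>\<in>P. \<forall>A\<in>\<B>. \<forall>A'\<in>\<B>.
        card {C \<in> \<C>. C \<subseteq> A} = card {C \<in> \<C>. C \<subseteq> A'})"

end

theory Submission
  imports Defs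
begin

text \<open>
  Fix a bloc \<open>\<C>\<close>. The numbers \<open>|{C \<in> \<C>. |A \<inter> C| = r}|\<close> are determined by the binomial moments
  \<open>\<Sum>C\<in>\<C>. (|A \<inter> C| choose i)\<close>, because the matrix of binomial coefficients is unitriangular
  (lemma \<open>binomial_moments_determine_distribution\<close>). It therefore suffices that each moment depends
  on \<open>A\<close> only through its bloc.

  The \<open>i\<close>-th moment counts the pairs \<open>(D, C)\<close> with \<open>|D| = i\<close>, \<open>C \<in> \<C>\<close> and \<open>D \<subseteq> A \<inter> C\<close>. Counting
  by \<open>D\<close> instead of by \<open>C\<close>, it is the sum, over the subsets \<open>D\<close> of \<open>A\<close> of size \<open>i\<close>, of the number
  of members of \<open>\<C>\<close> that contain \<open>D\<close> (lemma \<open>binomial_moment_eq_sum_subsets\<close>). The regularity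
  condition on included members, transported by complementation, shows that this number depends only
  on the bloc of \<open>D\<close> (lemma \<open>bloc_invariant_card_supersets\<close>); so does its restriction to
  \<open>|D| = i\<close>, because all members of a bloc have the same size. Finally, summing a function of the
  bloc of \<open>D\<close> over all \<open>D \<subseteq> A\<close> gives, by the regularity condition again, a function of the bloc
  of \<open>A\<close> (lemma \<open>bloc_invariant_sum_subsets\<close>).
\<close>

definition bloc_invariant :: "'a set set set \<Rightarrow> ('a set \<Rightarrow> 'b) \<Rightarrow> bool" where
  "bloc_invariant P w \<longleftrightarrow> (\<forall>\<B>\<in>P. \<forall>A\<in>\<B>. \<forall>A'\<in>\<B>. w A = w A')"

lemma bloc_invariantD:
  "bloc_invariant P w \<Longrightarrow> \<B> \<in> P \<Longrightarrow> A \<in> \<B> \<Longrightarrow> A' \<in> \<B> \<Longrightarrow> w A = w A'"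
  unfolding bloc_invariant_def by blast

lemma sum_comp_eq_sum_card_fibres:
  fixes f :: "'a \<Rightarrow> nat" and h :: "nat \<Rightarrow> nat"
  assumes "finite S" and "\<forall>x\<in>S. f x \<le> N"
  shows "(\<Sum>x\<in>S. h (f x)) = (\<Sum>j\<le>N. card {x \<in> S. f x = j} * h j)"
proof -
  have "(\<Sum>x\<in>S. h (f x)) = (\<Sum>j\<le>N. \<Sum>x\<in>{x \<in> S. f x = j}. h (f x))"
    using assms by (intro sum.group[symmetric]) auto
  also have "\<dots> = (\<Sum>j\<le>N. card {x \<in> S. f x = j} * h j)"
    by (intro sum.cong) auto
  finally show ?thesis .
qed

text \<open>
  The \<open>r\<close>-th moment is the number of points with value \<open>r\<close> plus contributions of the larger
  values only, so the distribution is recovered from the largest value downwards.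
\<close>

lemma binomial_moments_determine_distribution:
  fixes f g :: "'a \<Rightarrow> nat"
  assumes fin: "finite S"
    and moments: "\<And>i. (\<Sum>x\<in>S. f x choose i) = (\<Sum>x\<in>S. g x choose i)"
  shows "card {x \<in> S. f x = r} = card {x \<in> S. g x = r}"
proof -
  obtain N where N: "\<forall>x\<in>S. f x \<le> N" "\<forall>x\<in>S. g x \<le> N"
  proof
    show "\<forall>x\<in>S. f x \<le> Max (f ` S \<union> g ` S)" "\<forall>x\<in>S. g x \<le> Max (f ` S \<union> g ` S)"
      using fin by auto
  qed
  have moment_split: "(\<Sum>x\<in>S. k x choose r) =
      card {x \<in> S. k x = r} + (\<Sum>j\<in>{r<..N}. card {x \<in> S. k x = j} * (j choose r))"
    if "r \<le> N" "\<forall>x\<in>S. k x \<le> N" for k r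
  proof -
    have "(\<Sum>x\<in>S. k x choose r) = (\<Sum>j\<le>N. card {x \<in> S. k x = j} * (j choose r))"
      by (rule sum_comp_eq_sum_card_fibres[OF fin that(2)])
    also have "\<dots> = (\<Sum>j\<in>insert r {r<..N}. card {x \<in> S. k x = j} * (j choose r))"
      using that(1) by (intro sum.mono_neutral_right) auto
    finally show ?thesis by simp
  qed
  show ?thesis
  proof (induction "N - r" arbitrary: r rule: less_induct)
    case less
    show ?case
    proof (cases "r \<le> N")
      case True
      have "(\<Sum>j\<in>{r<..N}. card {x \<in> S. f x = j} * (j choose r)) =
            (\<Sum>j\<in>{r<..N}. card {x \<in> S. g x = j} * (j choose r))"
        using less by (intro sum.cong) auto
      then show ?thesis
        using moments[of r] moment_split[OF True N(1)] moment_split[OF True N(2)] by linarith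
    next
      case False
      then have "{x \<in> S. f x = r} = {}" "{x \<in> S. g x = r} = {}"
        using N by auto
      then show ?thesis by (simp only:)
    qed
  qed
qed

lemma binomial_moment_eq_sum_subsets:
  assumes "finite A" and "finite \<C>"
  shows "(\<Sum>C\<in>\<C>. card (A \<inter> C) choose i) =
         (\<Sum>D\<in>Pow A. if card D = i then card {C \<in> \<C>. D \<subseteq> C} else 0)"
proof -
  let ?S = "{D. D \<subseteq> A \<and> card D = i}"
  have "(\<Sum>C\<in>\<C>. card (A \<inter> C) choose i) = (\<Sum>C\<in>\<C>. card {D \<in> ?S. D \<subseteq> C})"
  proof (intro sum.cong refl)
    fix C
    have "{D \<in> ?S. D \<subseteq> C} = {D. D \<subseteq> A \<inter> C \<and> card D = i}" by blast
    moreover have "card {D. D \<subseteq> A \<inter> C \<and> card D = i} = card (A \<inter> C) choose i"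
      using assms(1) by (intro n_subsets) simp
    ultimately show "card (A \<inter> C) choose i = card {D \<in> ?S. D \<subseteq> C}"
      by (simp only:)
  qed
  also have "\<dots> = (\<Sum>D\<in>?S. card {C \<in> \<C>. D \<subseteq> C})"
    using assms by (intro sum_multicount_gen) auto
  also have "\<dots> = (\<Sum>D\<in>Pow A. if card D = i then card {C \<in> \<C>. D \<subseteq> C} else 0)"
    using assms(1) by (intro sum.mono_neutral_cong_left) auto
  finally show ?thesis .
qed

context
  fixes \<Omega> :: "'a set" and P :: "'a set set set"
  assumes fin: "finite \<Omega>" and srp: "strongly_regular_partition \<Omega> P"
begin

lemma partition: "partition_on (Pow \<Omega>) P"
  using srp unfolding strongly_regular_partition_def by blast

lemma complement_bloc: "\<B> \<in> P \<Longrightarrow> (\<lambda>A. \<Omega> - A) ` \<B> \<in> P"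
  using srp unfolding strongly_regular_partition_def by blast

lemma bloc_subset_Pow: "\<B> \<in> P \<Longrightarrow> \<B> \<subseteq> Pow \<Omega>"
  using partition by (auto simp: partition_on_def)

lemma finite_bloc: "\<B> \<in> P \<Longrightarrow> finite \<B>"
  using bloc_subset_Pow fin by (meson finite_Pow_iff finite_subset)

lemma bloc_invariant_card: "bloc_invariant P card"
  using srp unfolding strongly_regular_partition_def bloc_invariant_def by blast

lemma bloc_invariant_card_subsets:
  "\<C> \<in> P \<Longrightarrow> bloc_invariant P (\<lambda>A. card {C \<in> \<C>. C \<subseteq> A})"
  using srp unfolding strongly_regular_partition_def bloc_invariant_def by blast

text \<open>
  Complementation reverses inclusion and permutes the blocs, so the regularity condition has a dual
  form that counts supersets instead of subsets.
\<close>

lemma bloc_invariant_card_supersets: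
  assumes "\<C> \<in> P"
  shows "bloc_invariant P (\<lambda>D. card {C \<in> \<C>. D \<subseteq> C})"
proof -
  let ?c = "\<lambda>A. \<Omega> - A"
  have dual: "card {C \<in> \<C>. D \<subseteq> C} = card {C' \<in> ?c ` \<C>. C' \<subseteq> ?c D}" if "D \<subseteq> \<Omega>" for D
  proof -
    have "{C' \<in> ?c ` \<C>. C' \<subseteq> ?c D} = ?c ` {C \<in> \<C>. D \<subseteq> C}"
      using that by blast
    moreover have "inj_on ?c {C \<in> \<C>. D \<subseteq> C}"
      using bloc_subset_Pow[OF assms] by (intro inj_onI) blast
    ultimately show ?thesis by (simp add: card_image)
  qed
  show ?thesis
    unfolding bloc_invariant_def
  proof (intro ballI)
    fix \<B> D D' assume \<B>: "\<B> \<in> P" and D: "D \<in> \<B>" "D' \<in> \<B>"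
    have "D \<subseteq> \<Omega>" "D' \<subseteq> \<Omega>" using bloc_subset_Pow[OF \<B>] D by auto
    moreover have "card {C' \<in> ?c ` \<C>. C' \<subseteq> ?c D} = card {C' \<in> ?c ` \<C>. C' \<subseteq> ?c D'}"
      using bloc_invariantD[OF bloc_invariant_card_subsets[OF complement_bloc[OF assms]]
          complement_bloc[OF \<B>]] D by blast
    ultimately show "card {C \<in> \<C>. D \<subseteq> C} = card {C \<in> \<C>. D' \<subseteq> C}"
      by (simp only: dual)
  qed
qed

text \<open>
  Grouping the subsets of \<open>A\<close> by blocs, each bloc contributes the common value of \<open>w\<close> on it times
  the number of its members included in \<open>A\<close>, and both factors are constant on the bloc of \<open>A\<close>.
\<close>

lemma bloc_invariant_sum_subsets:
  fixes w :: "'a set \<Rightarrow> nat"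
  assumes w: "bloc_invariant P w"
  shows "bloc_invariant P (\<lambda>A. \<Sum>D\<in>Pow A. w D)"
proof -
  obtain v where v: "w D = v \<D>" if "\<D> \<in> P" "D \<in> \<D>" for \<D> D
  proof
    show "w D = w (SOME D. D \<in> \<D>)" if "\<D> \<in> P" "D \<in> \<D>" for \<D> D
      using bloc_invariantD[OF w that(1,2)] that(2) by (metis someI)
  qed
  have finP: "finite P"
    using finite_elements[OF _ partition] fin by simp
  have grouped: "(\<Sum>D\<in>Pow A. w D) = (\<Sum>\<D>\<in>P. card {D \<in> \<D>. D \<subseteq> A} * v \<D>)" if "A \<subseteq> \<Omega>" for A
  proof -
    have Un: "\<Union>P = Pow \<Omega>" and disj: "disjoint P"
      using partition by (auto simp: partition_on_def)
    have "Pow A = {D \<in> \<Union>P. D \<subseteq> A}"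
      unfolding Un using that by auto
    also have "\<dots> = (\<Union>\<D>\<in>P. {D \<in> \<D>. D \<subseteq> A})"
      by auto
    finally have "(\<Sum>D\<in>Pow A. w D) = (\<Sum>D\<in>(\<Union>\<D>\<in>P. {D \<in> \<D>. D \<subseteq> A}). w D)"
      by (simp only:)
    also have "\<dots> = (\<Sum>\<D>\<in>P. \<Sum>D\<in>{D \<in> \<D>. D \<subseteq> A}. w D)"
    proof (rule sum.UNION_disjoint[OF finP]; intro ballI impI)
      show "finite {D \<in> \<D>. D \<subseteq> A}" if "\<D> \<in> P" for \<D>
        using finite_bloc[OF that] by simp
      show "{D \<in> \<D>. D \<subseteq> A} \<inter> {D \<in> \<E>. D \<subseteq> A} = {}" if "\<D> \<in> P" "\<E> \<in> P" "\<D> \<noteq> \<E>" for \<D> \<E>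
        using disjointD[OF disj that] by blast
    qed
    also have "\<dots> = (\<Sum>\<D>\<in>P. card {D \<in> \<D>. D \<subseteq> A} * v \<D>)"
      using v by (intro sum.cong) simp_all
    finally show ?thesis .
  qed
  show ?thesis
    unfolding bloc_invariant_def
  proof (intro ballI)
    fix \<B> A A' assume \<B>: "\<B> \<in> P" and A: "A \<in> \<B>" "A' \<in> \<B>"
    have "(\<Sum>\<D>\<in>P. card {D \<in> \<D>. D \<subseteq> A} * v \<D>) = (\<Sum>\<D>\<in>P. card {D \<in> \<D>. D \<subseteq> A'} * v \<D>)"
    proof (intro sum.cong refl)
      fix \<D> assume "\<D> \<in> P"
      from bloc_invariantD[OF bloc_invariant_card_subsets[OF this] \<B> A]
      show "card {D \<in> \<D>. D \<subseteq> A} * v \<D> = card {D \<in> \<D>. D \<subseteq> A'} * v \<D>"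
        by simp
    qed
    moreover have "A \<subseteq> \<Omega>" "A' \<subseteq> \<Omega>"
      using bloc_subset_Pow[OF \<B>] A by auto
    ultimately show "(\<Sum>D\<in>Pow A. w D) = (\<Sum>D\<in>Pow A'. w D)"
      by (simp only: grouped)
  qed
qed

lemma binomial_moment_eq_on_bloc:
  assumes \<B>: "\<B> \<in> P" and A: "A \<in> \<B>" "A' \<in> \<B>" and \<C>: "\<C> \<in> P"
  shows "(\<Sum>C\<in>\<C>. card (A \<inter> C) choose i) = (\<Sum>C\<in>\<C>. card (A' \<inter> C) choose i)"
proof -
  let ?w = "\<lambda>D. if card D = i then card {C \<in> \<C>. D \<subseteq> C} else 0"
  have "finite A" "finite A'"
    using bloc_subset_Pow[OF \<B>] A fin by (auto intro: finite_subset)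
  moreover have "bloc_invariant P ?w"
    unfolding bloc_invariant_def
  proof (intro ballI)
    fix \<D> D D' assume \<D>: "\<D> \<in> P" "D \<in> \<D>" "D' \<in> \<D>"
    show "?w D = ?w D'"
      using bloc_invariantD[OF bloc_invariant_card \<D>]
        bloc_invariantD[OF bloc_invariant_card_supersets[OF \<C>] \<D>]
      by (simp only:)
  qed
  then have "(\<Sum>D\<in>Pow A. ?w D) = (\<Sum>D\<in>Pow A'. ?w D)"
    by (rule bloc_invariantD[OF bloc_invariant_sum_subsets \<B> A])
  ultimately show ?thesis
    using finite_bloc[OF \<C>] by (simp only: binomial_moment_eq_sum_subsets)
qed

end

theorem theorem1:
  fixes \<Omega> :: "'a set" and P :: "'a set set set"
  assumes "finite \<Omega>"
    and "strongly_regular_partition \<Omega> P"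
  shows "\<forall>\<B>\<in>P. \<forall>\<C>\<in>P. \<forall>r::int. \<forall>A\<in>\<B>. \<forall>A'\<in>\<B>.
           card {C \<in> \<C>. int (card (A \<inter> C)) = r} = card {C \<in> \<C>. int (card (A' \<inter> C)) = r}"
proof (intro ballI allI)
  fix \<B> \<C> A A' and r :: int
  assume \<B>: "\<B> \<in> P" and \<C>: "\<C> \<in> P" and A: "A \<in> \<B>" "A' \<in> \<B>"
  show "card {C \<in> \<C>. int (card (A \<inter> C)) = r} = card {C \<in> \<C>. int (card (A' \<inter> C)) = r}"
  proof (cases r)
    case (nonneg n)
    have "card {C \<in> \<C>. card (A \<inter> C) = n} = card {C \<in> \<C>. card (A' \<inter> C) = n}"
      by (rule binomial_moments_determine_distribution
          [OF finite_bloc[OF assms \<C>] binomial_moment_eq_on_bloc[OF assms \<B> A \<C>]])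
    with nonneg show ?thesis by simp
  qed simp
qed

end
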